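(* Let $m$ be a positive integer, $F=\mathbb{F}_{2^m}$, let $b\in F$ and put $a=b^2+b+1$. If $a\notin\{0,1\}$, then \[ K(a^4+a^3)\equiv\begin{cases}3\pmod{12}, & \text{if } m \text{ is odd},\\ 7\pmod{12}, & \text{if } m \text{ is even}.\end{cases} \]
   Context: $\mathrm{Tr}$ denotes the absolute trace from $F=\mathbb{F}_{2^m}$ to $\mathbb{F}_2$. For $a\in F\setminus\{0\}$, the Kloosterman sum is $K(a)=\sum_{x\in F\setminus\{0\}}(-1)^{\mathrm{Tr}(ax+1/x)}$. *)

theory Defs
  imports "HOL-Number_Theory.Number_Theory" "HOL-Library.Cardinality"
begin

text \<open>
  Throughout, \<open>'a\<close> is a field with \<open>2 ^ m\<close> elements. The absolute trace takes its values in the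
  prime field, which is the subset \<open>{0, 1}\<close> of \<open>'a\<close> (\<open>abs_trace_in_prime_field\<close> below).
\<close>

definition abs_trace :: "nat \<Rightarrow> 'a::finite_field \<Rightarrow> 'a" where
  "abs_trace m x = (\<Sum>i<m. x ^ (2 ^ i))"

text \<open>The exponent is the integer \<open>0\<close> or \<open>1\<close> representing the trace.\<close>

definition kloosterman :: "nat \<Rightarrow> 'a::finite_field \<Rightarrow> int" where
  "kloosterman m a = (\<Sum>x\<in>UNIV - {0}. (-1) ^ of_bool (abs_trace m (a * x + 1 / x) \<noteq> 0))"

lemma CHAR_eq_2:
  assumes "card (UNIV :: 'a::finite_field set) = 2 ^ m"
  shows "CHAR('a) = 2"
proof -
  have p: "prime CHAR('a)"
    by (rule prime_CHAR_semidom) (simp add: finite_imp_CHAR_pos)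
  moreover have "CHAR('a) dvd 2 ^ m"
    using CHAR_dvd_CARD[where 'a='a] assms by simp
  ultimately have "CHAR('a) dvd 2"
    using prime_dvd_power by blast
  with p show ?thesis
    using primes_dvd_imp_eq two_is_prime_nat by blast
qed

lemma abs_trace_in_prime_field:
  fixes x :: "'a::finite_field"
  assumes "CARD('a) = 2 ^ m"
  shows "abs_trace m x \<in> {0, 1}"
proof -
  have char: "CHAR('a) = 2" by (rule CHAR_eq_2[OF assms])
  have "abs_trace m x ^ 2 = (\<Sum>i<m. (x ^ (2 ^ i)) ^ 2)"
    unfolding abs_trace_def by (rule freshmans_dream_sum) (simp_all add: char)
  also have "\<dots> = (\<Sum>i<m. x ^ (2 ^ Suc i))"
    by (simp add: mult.commute flip: power_mult)
  also have "\<dots> = (\<Sum>i<Suc m. x ^ (2 ^ i)) - x"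
    by (subst sum.lessThan_Suc_shift) simp
  also have "\<dots> = abs_trace m x"
    using finite_field_power_card_eq_same[of x] assms by (simp add: abs_trace_def)
  finally have "abs_trace m x * (abs_trace m x - 1) = 0"
    by (simp add: power2_eq_square algebra_simps)
  thus ?thesis by auto
qed

end

theory Submission
  imports Defs "HOL-Computational_Algebra.Polynomial"
begin

text \<open>
  Modulo 4: \<open>x \<mapsto> 1 / (c x)\<close> preserves \<open>c x + 1 / x\<close>, and its only fixed point has
  \<open>c x + 1 / x = 0\<close>, so the number of \<open>x\<close> for which the trace is \<open>1\<close> is even.

  Modulo 3: substituting \<open>x = 1 / w + a\<close> and counting the solutions \<open>y\<close> by an Artin--Schreier
  argument shows that the curve \<open>y\<^sup>2 + x y + a y = x\<^sup>3\<close> has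
  \<open>2\<^sup>m + (-1)\<^bsup>Tr a\<^esup> K(a\<^sup>4 + a\<^sup>3)\<close> affine points. Translation by the 3-torsion point \<open>(0, 0)\<close>
  permutes the points with \<open>x \<noteq> 0\<close> in orbits of length 3. For \<open>a = b\<^sup>2 + b + 1\<close> the trace
  of \<open>a\<close> is \<open>m\<close> modulo 2.
\<close>

section \<open>Orbit counting, and translation by a point of order 3\<close>

lemma even_card_involution:
  assumes "finite S" and "\<And>x. x \<in> S \<Longrightarrow> f x \<in> S"
    and "\<And>x. x \<in> S \<Longrightarrow> f (f x) = x" and "\<And>x. x \<in> S \<Longrightarrow> f x \<noteq> x"
  shows "even (card S)"
proof -
  let ?C = "(\<lambda>x. {x, f x}) ` S"
  have U: "\<Union>?C = S" using assms(2) by auto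
  have "2 * card ?C = card (\<Union>?C)"
  proof (rule card_partition)
    show "finite ?C" "finite (\<Union>?C)" using assms(1) U by auto
    show "card c = 2" if "c \<in> ?C" for c using that assms(4) by (fastforce simp: card_insert_if)
    show "c1 \<inter> c2 = {}" if "c1 \<in> ?C" "c2 \<in> ?C" "c1 \<noteq> c2" for c1 c2
      using that assms(3) by (auto simp: insert_commute) (metis insert_commute)+
  qed
  hence "card S = 2 * card ?C" unfolding U by (rule sym)
  thus ?thesis by (rule dvdI)
qed

text \<open>Excluding fixed points is enough for orbits of size exactly 3: if
  \<open>f (f x) = x\<close>, applying \<open>f\<close> once more gives
  \<open>x = f x\<close>.\<close>

lemma three_dvd_card_order_3_map:
  assumes "finite S" and "\<And>x. x \<in> S \<Longrightarrow> f x \<in> S"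
    and "\<And>x. x \<in> S \<Longrightarrow> f (f (f x)) = x" and "\<And>x. x \<in> S \<Longrightarrow> f x \<noteq> x"
  shows "3 dvd card S"
proof -
  let ?C = "(\<lambda>x. {x, f x, f (f x)}) ` S"
  have U: "\<Union>?C = S" using assms(2) by auto
  have shift: "{f x, f (f x), f (f (f x))} = {x, f x, f (f x)}" if "x \<in> S" for x
    using assms(3)[OF that] by auto
  have "3 * card ?C = card (\<Union>?C)"
  proof (rule card_partition)
    show "finite ?C" "finite (\<Union>?C)" using assms(1) U by auto
    show "card c = 3" if "c \<in> ?C" for c
    proof -
      from that obtain x where x: "x \<in> S" "c = {x, f x, f (f x)}" by auto
      have "f x \<noteq> x" "f (f x) \<noteq> f x" "f (f x) \<noteq> x"
        using assms(2-4) x(1) by metis+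
      thus ?thesis by (simp add: x(2))
    qed
    show "c1 \<inter> c2 = {}" if c: "c1 \<in> ?C" "c2 \<in> ?C" "c1 \<noteq> c2" for c1 c2
    proof -
      \<comment> \<open>Every element of an orbit generates it, so two orbits with a common element
        coincide.\<close>
      have *: "c = {z, f z, f (f z)}" if "c \<in> ?C" "z \<in> c" for c z
      proof -
        from that obtain x where x: "x \<in> S" "c = {x, f x, f (f x)}" by auto
        with that(2) have "z = x \<or> z = f x \<or> z = f (f x)" by auto
        thus ?thesis using x(2) shift[of x] shift[of "f x"] assms(2) x(1) by metis
      qed
      have "c1 = c2" if "z \<in> c1" "z \<in> c2" for z
        using *[OF c(1) that(1)] *[OF c(2) that(2)] by simp
      thus ?thesis using c(3) by blast
    qed
  qed
  hence "card S = 3 * card ?C" unfolding U by (rule sym)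
  thus ?thesis by (rule dvdI)
qed

text \<open>On \<open>y\<^sup>2 + x y + a y = x\<^sup>3\<close> the point \<open>(0, 0)\<close> has order 3, and translation by it is
  \<open>(x, y) \<mapsto> (- a y / x\<^sup>2, - a\<^sup>2 y / x\<^sup>3)\<close>; the excluded points \<open>(0, 0)\<close>, \<open>(0, - a)\<close> and the point
  at infinity form one orbit. The discriminant of the curve is \<open>a\<^sup>3 (1 - 27 a)\<close>.\<close>

lemma three_dvd_card_curve_points:
  fixes a :: "'a::finite_field"
  assumes "a \<noteq> 0" "27 * a \<noteq> 1"
  shows "3 dvd card {(x, y). x \<noteq> 0 \<and> y\<^sup>2 + x * y + a * y = x ^ 3}"
proof (rule three_dvd_card_order_3_map)
  let ?S = "{(x, y). x \<noteq> 0 \<and> y\<^sup>2 + x * y + a * y = x ^ 3}"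
  let ?f = "\<lambda>(x, y). (- a * y / x ^ 2, - (a ^ 2) * y / x ^ 3)"
  show "finite ?S" by simp
  fix p assume "p \<in> ?S"
  then obtain x y where p: "p = (x, y)" and x: "x \<noteq> 0" and eq: "y\<^sup>2 + x * y + a * y = x ^ 3"
    by auto
  from x eq have y: "y \<noteq> 0" by auto
  let ?x = "- a * y / x ^ 2" and ?y = "- (a ^ 2) * y / x ^ 3"
  \<comment> \<open>The equation at the image point is a multiple of the equation at
    \<open>(x, y)\<close>.\<close>
  have "?y\<^sup>2 + ?x * ?y + a * ?y - ?x ^ 3 =
      a ^ 3 * y / x ^ 6 * (y\<^sup>2 + x * y + a * y - x ^ 3)"
    using x by (simp add: divide_simps) (simp add: algebra_simps power_numeral_reduce)
  also have "\<dots> = 0" using eq by simp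
  finally have "?y\<^sup>2 + ?x * ?y + a * ?y = ?x ^ 3" by (rule eq_iff_diff_eq_0[THEN iffD2])
  thus "?f p \<in> ?S" using x y assms(1) by (simp add: p)
  \<comment> \<open>The second iterate in closed form, which is translation by
    \<open>(0, - a)\<close>, the inverse of \<open>(0, 0)\<close>; this avoids expanding threefold
    nested fractions.\<close>
  have "- a * ?y / ?x ^ 2 = a * x / y" "- (a ^ 2) * ?y / ?x ^ 3 = - a * x ^ 3 / y ^ 2"
    using x y assms(1) by (simp_all add: field_simps eval_nat_numeral)
  hence "?f (?f p) = (a * x / y, - a * x ^ 3 / y ^ 2)" unfolding p prod.case by simp
  moreover have "- a * (- a * x ^ 3 / y ^ 2) / (a * x / y) ^ 2 = x"
      "- (a ^ 2) * (- a * x ^ 3 / y ^ 2) / (a * x / y) ^ 3 = y"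
    using x y assms(1) by (simp_all add: field_simps eval_nat_numeral)
  ultimately show "?f (?f (?f p)) = p" by (simp only: p prod.case)
  show "?f p \<noteq> p"
  proof
    \<comment> \<open>A fixed point would have to be \<open>(- 3 * a, a)\<close>, and this is a
      point of the curve only if \<open>27 * a = 1\<close>, when it is singular.\<close>
    assume "?f p = p"
    hence *: "- a * y = x ^ 3" "- (a ^ 2) * y = y * x ^ 3"
      using x by (simp_all add: p field_simps eval_nat_numeral)
    from *(2) y have x3: "x ^ 3 = - (a ^ 2)" by (metis mult.commute mult_left_cancel mult_minus_left)
    with *(1) assms(1) have ya: "y = a" by (simp add: power2_eq_square)
    from eq x3 ya have "a * (x + 3 * a) = 0" by (simp add: algebra_simps power2_eq_square)
    with assms(1) have "x = - 3 * a" by (simp add: eq_neg_iff_add_eq_0)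
    with x3 have "a ^ 2 * (27 * a - 1) = 0" by (simp add: algebra_simps power_numeral_reduce)
    with assms show False by simp
  qed
qed

section \<open>Characteristic 2 and the absolute trace\<close>

context
  fixes m :: nat
  assumes card_field: "CARD('a::finite_field) = 2 ^ m"
begin

private lemma char_2: "CHAR('a) = 2"
  by (rule CHAR_eq_2[OF card_field])

private lemma two_eq_0: "(2 :: 'a) = 0"
  using of_nat_CHAR[where 'a='a] char_2 by simp

private lemma add_self: "(x :: 'a) + x = 0"
  using two_eq_0 by (metis mult_2 mult_zero_left)

private lemma minus_eq: "- (x :: 'a) = x"
  using add_self by (simp add: neg_eq_iff_add_eq_0)

private lemma diff_eq: "(x :: 'a) - y = x + y"
  using minus_eq by (metis diff_conv_add_uminus)

private lemma add_eq_0_iff_eq: "(x :: 'a) + y = 0 \<longleftrightarrow> x = y"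
  by (metis add_eq_0_iff2 minus_eq)

private lemma square_add: "((x :: 'a) + y)\<^sup>2 = x\<^sup>2 + y\<^sup>2"
  using two_eq_0 by (simp add: power2_sum)

lemma abs_trace_add: "abs_trace m ((x :: 'a) + y) = abs_trace m x + abs_trace m y"
proof -
  have "(x + y) ^ 2 ^ i = x ^ 2 ^ i + y ^ 2 ^ i" for i
    by (induction i) (simp_all add: power_mult square_add mult.commute[of 2])
  thus ?thesis by (simp add: abs_trace_def sum.distrib)
qed

text \<open>Squaring shifts the summands of the trace cyclically, because
  \<open>x ^ (2 ^ m) = x\<close>.\<close>

lemma abs_trace_square: "abs_trace m ((x :: 'a)\<^sup>2) = abs_trace m x"
proof -
  have "abs_trace m (x\<^sup>2) = (\<Sum>i<m. x ^ (2 ^ Suc i))"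
    by (simp add: abs_trace_def flip: power_mult)
  also have "\<dots> = (\<Sum>i<Suc m. x ^ (2 ^ i)) - x"
    by (subst sum.lessThan_Suc_shift) simp
  also have "\<dots> = abs_trace m x"
    using finite_field_power_card_eq_same[of x] card_field by (simp add: abs_trace_def)
  finally show ?thesis .
qed

lemma abs_trace_1: "abs_trace m (1 :: 'a) = of_nat m"
  by (simp add: abs_trace_def)

lemma bij_square: "bij (\<lambda>x :: 'a. x\<^sup>2)"
proof -
  have "inj (\<lambda>x :: 'a. x\<^sup>2)"
  proof (rule injI)
    fix x y :: 'a assume "x\<^sup>2 = y\<^sup>2"
    hence "(x + y)\<^sup>2 = 0" using square_add add_self by metis
    thus "x = y" by (simp add: add_eq_0_iff_eq)
  qed
  thus ?thesis by (simp add: bij_def finite_UNIV_inj_surj)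
qed

text \<open>The canonical additive character, with integer values so that its sums can be compared
  with cardinalities.\<close>

private definition chi :: "'a \<Rightarrow> int" where
  "chi x = (-1) ^ of_bool (abs_trace m x \<noteq> 0)"

private lemma chi_add: "chi (x + y) = chi x * chi y"
  using abs_trace_in_prime_field[OF card_field, of x]
    abs_trace_in_prime_field[OF card_field, of y] add_self[of 1]
  by (auto simp: chi_def abs_trace_add)

private lemma kloosterman_chi: "kloosterman m c = (\<Sum>x\<in>UNIV - {0}. chi (c * x + 1 / x))"
  by (simp add: kloosterman_def chi_def)

private lemma m_pos: "m > 0"
proof (rule ccontr)
  assume "\<not> m > 0"
  hence "card (UNIV :: 'a set) = 1" using card_field by simp
  then obtain z :: 'a where "UNIV = {z}" by (auto simp: card_1_singleton_iff)
  thus False by (metis UNIV_I singletonD zero_neq_one)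
qed

section \<open>Artin-Schreier equations\<close>

text \<open>The trace is a nonzero polynomial function of degree at most \<open>2 ^ (m - 1)\<close>,
  too small to vanish on all \<open>2 ^ m\<close> elements.\<close>

lemma exists_abs_trace_nonzero: "\<exists>x :: 'a. abs_trace m x \<noteq> 0"
proof (rule ccontr)
  assume none: "\<not> (\<exists>x :: 'a. abs_trace m x \<noteq> 0)"
  define p :: "'a poly" where "p = (\<Sum>i<m. monom 1 (2 ^ i))"
  have "poly p x = abs_trace m x" for x
    by (simp add: p_def abs_trace_def poly_sum poly_monom)
  with none have roots: "{x. poly p x = 0} = UNIV" by auto
  have "coeff p 1 = (\<Sum>i<m. if i = 0 then 1 else 0)"
    by (simp add: p_def coeff_sum)
  also have "\<dots> = 1" using m_pos by (simp add: sum.delta)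
  finally have "p \<noteq> 0" by auto
  hence "card (UNIV :: 'a set) \<le> degree p"
    using card_poly_roots_bound[of p] roots by simp
  also have "degree p \<le> 2 ^ (m - 1)"
    unfolding p_def
  proof (rule degree_sum_le)
    fix i assume "i \<in> {..<m}"
    hence "(2 :: nat) ^ i \<le> 2 ^ (m - 1)" by (intro power_increasing) auto
    thus "degree (monom (1 :: 'a) (2 ^ i)) \<le> 2 ^ (m - 1)"
      using degree_monom_le order_trans by blast
  qed simp
  also have "\<dots> < (2 :: nat) ^ m" using m_pos by simp
  finally show False using card_field by simp
qed

private lemma square_add_self_eq_iff: "(y :: 'a)\<^sup>2 + y = z\<^sup>2 + z \<longleftrightarrow> y = z \<or> y = z + 1"
proof -
  have "y\<^sup>2 + y = z\<^sup>2 + z \<longleftrightarrow> (y\<^sup>2 + y) - (z\<^sup>2 + z) = 0" by simp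
  also have "(y\<^sup>2 + y) - (z\<^sup>2 + z) = (y + z) * (y + z + 1)"
    using square_add[of y z] by (simp only: diff_eq) (simp add: algebra_simps power2_eq_square)
  also have "\<dots> = 0 \<longleftrightarrow> y = z \<or> y = z + 1"
    by (simp add: add_eq_0_iff_eq add.assoc)
  finally show ?thesis .
qed

text \<open>One inclusion follows from invariance of the trace under squaring. Equality holds
  because both sets contain half of the field: the map is two-to-one, and the trace takes each of
  its two values equally often.\<close>

lemma range_square_add_self: "range (\<lambda>y :: 'a. y\<^sup>2 + y) = {t. abs_trace m t = 0}"
proof (rule card_subset_eq)
  let ?h = "\<lambda>y :: 'a. y\<^sup>2 + y" and ?Z = "{t :: 'a. abs_trace m t = 0}"
  show "range ?h \<subseteq> ?Z" using add_self by (auto simp: abs_trace_add abs_trace_square)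
  have fib: "card (?h -` {t}) = 2" if "t \<in> range ?h" for t
  proof -
    from that obtain z where t: "t = ?h z" by auto
    have "?h -` {t} = {z, z + 1}" using square_add_self_eq_iff[of _ z] by (auto simp: t)
    thus ?thesis by simp
  qed
  have "card (UNIV :: 'a set) = (\<Sum>t\<in>range ?h. card (?h -` {t}))"
    using sum.image_gen[of "UNIV :: 'a set" "\<lambda>_. 1::nat" ?h] by (simp add: vimage_def)
  also have "\<dots> = 2 * card (range ?h)" using fib by simp
  finally have 1: "card (UNIV :: 'a set) = 2 * card (range ?h)" .
  obtain u :: 'a where "abs_trace m u \<noteq> 0" using exists_abs_trace_nonzero by auto
  hence u: "abs_trace m u = 1" using abs_trace_in_prime_field[OF card_field, of u] by auto
  \<comment> \<open>Translation by an element of trace 1 exchanges the two trace classes.\<close>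
  have "(+) u ` ?Z = - ?Z"
  proof (intro equalityI subsetI)
    fix t assume "t \<in> - ?Z"
    hence "abs_trace m t = 1" using abs_trace_in_prime_field[OF card_field, of t] by auto
    hence "u + t \<in> ?Z" using u two_eq_0 by (simp add: abs_trace_add)
    moreover have "t = u + (u + t)" using add_self[of u] by (simp flip: add.assoc)
    ultimately show "t \<in> (+) u ` ?Z" by blast
  qed (auto simp: abs_trace_add u)
  hence "card (- ?Z) = card ?Z" using card_image[of "(+) u" ?Z] by simp
  moreover have "card (UNIV :: 'a set) = card ?Z + card (- ?Z)"
    using card_Un_disjoint[of ?Z "- ?Z"] by (simp add: Compl_partition)
  ultimately show "card (range ?h) = card ?Z" using 1 by simp
qed simp

private lemma card_artin_schreier: "int (card {y. y\<^sup>2 + y = t}) = 1 + chi t"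
proof (cases "abs_trace m t = 0")
  case False
  hence "{y. y\<^sup>2 + y = t} = {}" using range_square_add_self by auto
  thus ?thesis using False by (simp add: chi_def)
next
  case True
  then obtain z where t: "t = z\<^sup>2 + z" using range_square_add_self by blast
  have "{y. y\<^sup>2 + y = t} = {z, z + 1}"
    using square_add_self_eq_iff[of _ z] by (auto simp: t)
  thus ?thesis using True by (simp add: chi_def)
qed

text \<open>The substitution \<open>y = u * w\<close> reduces this to the Artin-Schreier
  case.\<close>

private lemma card_quadratic:
  assumes "u \<noteq> 0"
  shows "int (card {y. y\<^sup>2 + u * y = t}) = 1 + chi (t / u\<^sup>2)"
proof -
  have "{y. y\<^sup>2 + u * y = t} = (*) u ` {w. w\<^sup>2 + w = t / u\<^sup>2}"
  proof (intro equalityI subsetI)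
    fix y assume y: "y \<in> {y. y\<^sup>2 + u * y = t}"
    have "y = u * (y / u)" using assms by simp
    moreover have "(y / u)\<^sup>2 + y / u = t / u\<^sup>2"
      using assms y by (auto simp: field_simps power2_eq_square)
    ultimately show "y \<in> (*) u ` {w. w\<^sup>2 + w = t / u\<^sup>2}" by blast
  next
    fix y assume "y \<in> (*) u ` {w. w\<^sup>2 + w = t / u\<^sup>2}"
    thus "y \<in> {y. y\<^sup>2 + u * y = t}"
      using assms by (auto simp: field_simps power2_eq_square)
  qed
  hence "card {y. y\<^sup>2 + u * y = t} = card {w. w\<^sup>2 + w = t / u\<^sup>2}"
    using assms by (simp add: card_image inj_on_def)
  thus ?thesis by (simp add: card_artin_schreier)
qed

section \<open>Kloosterman sums as point counts\<close>

text \<open>Squaring permutes the nonzero elements. The squared variable is the form that comes out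
  of the point count.\<close>

private lemma kloosterman_squares:
  "kloosterman m c = (\<Sum>w\<in>UNIV - {0}. chi (c * w\<^sup>2 + 1 / w\<^sup>2))"
proof -
  have "bij_betw (\<lambda>x :: 'a. x\<^sup>2) (UNIV - {0}) (UNIV - {0})"
    using bij_betw_DiffI[OF bij_square, of "{0}" "{0}"] by (simp add: bij_betw_def)
  from sum.reindex_bij_betw[OF this, of "\<lambda>x. chi (c * x + 1 / x)"]
  show ?thesis by (simp add: kloosterman_chi)
qed

text \<open>The points are counted fibrewise over \<open>x\<close>. Over \<open>x = a\<close> the
  term linear in \<open>y\<close> vanishes, leaving one square root; over any other \<open>x\<close>
  the fibre is an Artin-Schreier count in the variable \<open>w = 1 / (x + a)\<close>.\<close>

private lemma card_curve:
  "int (card {(x, y :: 'a). y\<^sup>2 + x * y + a * y = x ^ 3}) =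
    2 ^ m + chi a * kloosterman m (a ^ 4 + a ^ 3)"
proof -
  let ?g = "\<lambda>x. int (card {y. y\<^sup>2 + x * y + a * y = x ^ 3})"
  have "{(x, y :: 'a). y\<^sup>2 + x * y + a * y = x ^ 3} =
      (SIGMA x:UNIV. {y. y\<^sup>2 + x * y + a * y = x ^ 3})" by auto
  hence "int (card {(x, y :: 'a). y\<^sup>2 + x * y + a * y = x ^ 3}) = (\<Sum>x\<in>UNIV. ?g x)"
    by (simp add: card_SigmaI)
  also have "\<dots> = ?g a + (\<Sum>x\<in>UNIV - {a}. ?g x)"
    by (rule sum.remove) auto
  also have "?g a = 1"
  proof -
    obtain r where r: "a ^ 3 = r\<^sup>2" using bij_square by (metis bij_pointE)
    have "y\<^sup>2 + a * y + a * y = a ^ 3 \<longleftrightarrow> y = r" for y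
      using r bij_square add_self[of "a * y"] by (auto simp: add.assoc bij_def dest: injD)
    thus ?thesis by simp
  qed
  also have "(\<Sum>x\<in>UNIV - {a}. ?g x) =
      (\<Sum>w\<in>UNIV - {0}. 1 + chi a * chi ((a ^ 4 + a ^ 3) * w\<^sup>2 + 1 / w\<^sup>2))"
  proof (rule sum.reindex_bij_witness[of _ "\<lambda>w. 1 / w + a" "\<lambda>x. 1 / (x + a)"])
    fix x assume "x \<in> UNIV - {a}"
    hence x: "x + a \<noteq> 0" by (auto simp: add_eq_0_iff_eq)
    define w where "w = 1 / (x + a)"
    have w: "w \<noteq> 0" using x by (simp add: w_def)
    have xw: "x = 1 / w + a" "x + a = 1 / w"
      using add_self[of a] by (simp_all add: w_def add.assoc)
    from xw(1) show "1 / (1 / (x + a)) + a = x" by (simp add: w_def)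
    show "1 / (x + a) \<in> UNIV - {0}" using x by simp
    have "?g x = 1 + chi (x ^ 3 / (x + a)\<^sup>2)"
      using card_quadratic[OF x, of "x ^ 3"] by (simp add: algebra_simps)
    also have "x ^ 3 / (x + a)\<^sup>2 = (1 / w + a) ^ 3 * w\<^sup>2"
      by (simp add: xw(2)) (simp add: xw(1) power_divide)
    also have "\<dots> = 1 / w + 3 * a + 3 * (a\<^sup>2 * w) + a ^ 3 * w\<^sup>2"
      using w by (simp add: field_simps power_numeral_reduce)
    also have "(3 :: 'a) = 1" using two_eq_0 by (metis add_0 numeral_plus_one semiring_norm(5) one_add_one)
    also have "chi (1 / w + 1 * a + 1 * (a\<^sup>2 * w) + a ^ 3 * w\<^sup>2) =
        chi (1 / w) * chi a * chi (a\<^sup>2 * w) * chi (a ^ 3 * w\<^sup>2)" by (simp add: chi_add)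
    \<comment> \<open>Invariance under squaring replaces \<open>1 / w\<close> and
      \<open>a\<^sup>2 * w\<close> by their squares, which gives the shape of
      \<open>kloosterman_squares\<close>.\<close>
    also have "chi (1 / w) = chi (1 / w\<^sup>2)"
      using abs_trace_square[of "1 / w"] by (simp add: chi_def power_divide)
    also have "chi (a\<^sup>2 * w) = chi (a ^ 4 * w\<^sup>2)"
      using abs_trace_square[of "a\<^sup>2 * w"] by (simp add: chi_def power_mult_distrib)
    finally show "1 + chi a * chi ((a ^ 4 + a ^ 3) * (1 / (x + a))\<^sup>2 + 1 / (1 / (x + a))\<^sup>2) = ?g x"
      by (simp only: w_def[symmetric] distrib_right chi_add mult_ac) (simp only: distrib_left chi_add mult_ac)
  next
    fix w :: 'a assume "w \<in> UNIV - {0}"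
    thus "1 / (1 / w + a + a) = w" "1 / w + a \<in> UNIV - {a}"
      by (simp_all add: add.assoc add_self)
  qed
  also have "\<dots> = int (card (UNIV - {0 :: 'a})) + chi a * kloosterman m (a ^ 4 + a ^ 3)"
    by (simp add: sum.distrib kloosterman_squares sum_distrib_left)
  also have "int (card (UNIV - {0 :: 'a})) = 2 ^ m - 1"
    by (simp add: card_Diff_singleton card_field of_nat_diff)
  finally show ?thesis by simp
qed

section \<open>Congruences modulo 3, 4 and 12\<close>

text \<open>The \<open>- 2\<close> removes the affine points with \<open>x = 0\<close>. In
  characteristic 2 the condition \<open>27 * a \<noteq> 1\<close> reads
  \<open>a \<noteq> 1\<close>.\<close>

private lemma kloosterman_mod_3:
  assumes "a \<noteq> 0" "a \<noteq> 1"
  shows "3 dvd 2 ^ m - 2 + chi a * kloosterman m (a ^ 4 + a ^ 3)"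
proof -
  let ?S = "{(x, y :: 'a). x \<noteq> 0 \<and> y\<^sup>2 + x * y + a * y = x ^ 3}"
  have eq: "{(x, y :: 'a). y\<^sup>2 + x * y + a * y = x ^ 3} = ?S \<union> {(0, 0), (0, a)}"
  proof -
    have zero: "y\<^sup>2 + a * y = 0 \<longleftrightarrow> y = 0 \<or> y = a" for y
    proof -
      have "y\<^sup>2 + a * y = y * (y + a)" by (simp add: algebra_simps power2_eq_square)
      thus ?thesis by (simp add: add_eq_0_iff_eq)
    qed
    have "p \<in> {(x, y). y\<^sup>2 + x * y + a * y = x ^ 3} \<longleftrightarrow> p \<in> ?S \<union> {(0, 0), (0, a)}" for p
      using zero[of "snd p"] by (cases p; cases "fst p = 0") simp_all
    thus ?thesis by blast
  qed
  have "card (?S \<union> {(0, 0), (0, a)}) = card ?S + card {(0 :: 'a, 0), (0, a)}"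
    by (rule card_Un_disjoint) auto
  hence eq_S: "int (card ?S) = 2 ^ m - 2 + chi a * kloosterman m (a ^ 4 + a ^ 3)"
    using card_curve[of a] assms(1) by (simp add: eq)
  have "(27 :: 'a) = 1"
  proof -
    have "(27 :: 'a) = 2 * 13 + 1" by simp
    thus ?thesis using two_eq_0 by simp
  qed
  hence "3 dvd card ?S" using assms by (intro three_dvd_card_curve_points) auto
  hence "int 3 dvd int (card ?S)" by (simp only: int_dvd_int_iff)
  thus ?thesis unfolding eq_S by simp
qed

text \<open>If \<open>N\<close> is the set of \<open>x\<close> with trace 1, the sum is
  \<open>2 ^ m - 1 - 2 * card N\<close>; here \<open>card N\<close> is even, and 4 divides
  \<open>2 ^ m\<close> since \<open>m \<ge> 2\<close>.\<close>

lemma kloosterman_cong_3_mod_4: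
  fixes c :: 'a
  assumes "m \<ge> 2" "c \<noteq> 0"
  shows "[kloosterman m c = 3] (mod 4)"
proof -
  let ?t = "\<lambda>x. abs_trace m (c * x + 1 / x)"
  define N where "N = {x :: 'a. x \<noteq> 0 \<and> ?t x \<noteq> 0}"
  have "even (card N)"
  proof (rule even_card_involution)
    fix x assume x: "x \<in> N"
    have "c * (1 / (c * x)) + 1 / (1 / (c * x)) = c * x + 1 / x"
      using x assms(2) by (simp add: N_def)
    thus "1 / (c * x) \<in> N" using x assms(2) unfolding N_def by (simp only: mem_Collect_eq) simp
    show "1 / (c * (1 / (c * x))) = x" using assms(2) by simp
    show "1 / (c * x) \<noteq> x"
    proof
      assume "1 / (c * x) = x"
      hence "1 / x = c * x" using x assms(2) by (auto simp: N_def field_simps)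
      hence "?t x = abs_trace m 0" by (simp only: add_self)
      thus False using x by (simp add: N_def abs_trace_def power_0_left)
    qed
  qed simp
  then obtain k where k: "card N = 2 * k" by blast
  have "kloosterman m c = (\<Sum>x\<in>UNIV - {0}. 1 - 2 * of_bool (?t x \<noteq> 0))"
    unfolding kloosterman_def by (rule sum.cong) auto
  also have "\<dots> = int (card (UNIV - {0 :: 'a})) - 2 * int (card N)"
    by (simp add: sum_subtractf N_def Int_def flip: sum_distrib_left)
  also have "int (card (UNIV - {0 :: 'a})) = 2 ^ m - 1"
    by (simp add: card_Diff_singleton card_field of_nat_diff)
  finally have eq: "kloosterman m c - 3 = 2 ^ m - 4 * (int k + 1)" by (simp add: k)
  have "(4 :: int) dvd 2 ^ m" using le_imp_power_dvd[OF assms(1), of "2 :: int"] by simp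
  thus ?thesis unfolding cong_iff_dvd_diff eq by (rule dvd_diff) simp
qed

lemma kloosterman_cong_mod_12:
  fixes a b :: 'a
  assumes "a = b\<^sup>2 + b + 1" "a \<notin> {0, 1}"
  shows "if odd m then [kloosterman m (a ^ 4 + a ^ 3) = 3] (mod 12)
         else [kloosterman m (a ^ 4 + a ^ 3) = 7] (mod 12)"
proof -
  let ?K = "kloosterman m (a ^ 4 + a ^ 3)"
  \<comment> \<open>Over the field with two elements \<open>b\<^sup>2 + b = 0\<close>, which would
    force \<open>a = 1\<close>.\<close>
  have "m \<noteq> 1"
  proof
    assume "m = 1"
    hence "b\<^sup>2 = b" using finite_field_power_card_eq_same[of b] card_field by simp
    thus False using assms add_self by simp
  qed
  with m_pos have m: "m \<ge> 2" by linarith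
  have "a ^ 4 + a ^ 3 = a ^ 3 * (a + 1)" by (simp add: algebra_simps power_numeral_reduce)
  hence "a ^ 4 + a ^ 3 \<noteq> 0" using assms(2) by (simp add: add_eq_0_iff_eq)
  with m have 4: "[?K = 3] (mod 4)" by (rule kloosterman_cong_3_mod_4)
  \<comment> \<open>The traces of \<open>b\<^sup>2\<close> and \<open>b\<close> cancel, leaving the
    trace of 1.\<close>
  have "abs_trace m a = of_nat m"
    using add_self by (simp add: assms(1) abs_trace_add abs_trace_square abs_trace_1)
  also have "of_nat m = (0 :: 'a) \<longleftrightarrow> even m"
    by (simp add: of_nat_eq_0_iff_char_dvd char_2)
  finally have chi: "chi a = (if odd m then -1 else 1)" by (auto simp: chi_def)
  have 3: "3 dvd 2 ^ m - 2 + chi a * ?K" using kloosterman_mod_3 assms(2) by simp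
  \<comment> \<open>Since \<open>chi a\<close> is also \<open>(-1) ^ m\<close>, the divisibility by
    3 becomes \<open>?K\<close> congruent to \<open>2 * (-1) ^ m - 1\<close>, that is 0 for odd and
    1 for even \<open>m\<close>. Together with 3 modulo 4 this gives 3 and 7 modulo 12.\<close>
  have "[(2 :: int) ^ m = (-1) ^ m] (mod 3)" by (rule cong_pow) (simp add: cong_def)
  hence pow: "3 dvd (2 :: int) ^ m - (-1) ^ m" by (simp add: cong_iff_dvd_diff)
  have four: "4 dvd ?K - 3" using 4 by (simp add: cong_iff_dvd_diff)
  show ?thesis
  proof (cases "odd m")
    case True
    hence "12 dvd ?K - 3" using 3 four pow chi by simp presburger
    thus ?thesis using True by (simp add: cong_iff_dvd_diff)
  next
    case False
    hence "12 dvd ?K - 7" using 3 four pow chi by simp presburger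
    thus ?thesis using False by (simp add: cong_iff_dvd_diff)
  qed
qed

end

theorem theorem3:
  fixes m :: nat and a b :: "'a::finite_field"
  assumes "m > 0"
    and "CARD('a) = 2 ^ m"
    and "a = b ^ 2 + b + 1"
    and "a \<notin> {0, 1}"
  shows "if odd m then [kloosterman m (a ^ 4 + a ^ 3) = 3] (mod 12)
         else [kloosterman m (a ^ 4 + a ^ 3) = 7] (mod 12)"
  using assms(2-4) by (rule kloosterman_cong_mod_12)

end
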